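(* Let $G$ be a clustered graph on $mn$ vertices with clusters $C_i=\{v_{i,1},\dots,v_{i,m}\}$, $i=1,\dots,n$, and adjacency blocks $A_{i,j}$, satisfying: (1) (Commuting condition) for all $i_1,j_1,i_2,j_2\in\{1,\dots,n\}$ and $\alpha,\beta\in\{1,\dots,m\}$, $\left|\mathrm{nbd}_{C_{j_1}}(v_{i_1,\alpha})\cap \mathrm{nbd}_{C_{i_2}}(v_{j_2,\beta})\right| = \left|\mathrm{nbd}_{C_{i_1}}(v_{j_1,\beta})\cap \mathrm{nbd}_{C_{j_2}}(v_{i_2,\alpha})\right|$; (2) (Normality condition) for all $i\neq j$ and $\alpha,\beta$, the number of common neighbours in $C_j$ of $v_{i,\alpha},v_{i,\beta}$ equals the number of common neighbours in $C_i$ of $v_{j,\alpha},v_{j,\beta}$. Let $k\geq 2$ and let $H$ be a clustered graph on $km$ vertices with clusters $D_1,\dots,D_k$, each of $m$ vertices, such that each $D_p$ is a (labelled) copy of some cluster of $G$, i.e. the diagonal block of the adjacency matrix of $H$ for $D_p$ equals $A_{i,i}$ for some $i\in\{1,\dots,n\}$, and for every $p\neq q$ the block $D_{p,q}$ describing the adjacencies between $D_p$ and $D_q$ satisfies $D_{p,q}\in\{I_m,0_{m\times m}\}\cup\{A_{i,j}: i\neq j,\ 1\leq i,j\leq n\}$. Then $H$ and its graph theoretical partial transpose $H^\tau$ are cospectral.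
   Context: All graphs are finite, simple and undirected. A clustered graph with clusters $C_i=\{v_{i,1},\dots,v_{i,m}\}$, $i=1,\dots,n$, has adjacency matrix written as the block matrix $[A_{i,j}]$ with $(A_{i,j})_{\alpha\beta}=1$ iff $v_{i,\alpha}$ and $v_{j,\beta}$ are adjacent. $\mathrm{nbd}_{C_j}(v_{i,\alpha})=\{\beta : v_{i,\alpha}\sim v_{j,\beta}\}\subseteq\{1,\dots,m\}$. The graph theoretical partial transpose of a clustered graph with adjacency matrix $[A_{i,j}]$ is the graph on the same vertex set with adjacency matrix $[A_{i,j}^t]$; equivalently, edges inside clusters and edges $(v_{i,k},v_{j,k})$ are kept and each edge $(v_{i,k},v_{j,l})$ with $i\neq j$, $k\neq l$ is replaced by $(v_{i,l},v_{j,k})$. Cospectral means equal multisets of adjacency eigenvalues. *)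

theory Defs
  imports
    "Graph_Theory.Pair_Digraph"
    "Jordan_Normal_Form.Char_Poly"
begin

text \<open>
  Finite simple undirected graphs are the \<^const>\<open>pair_graph\<close>s of the Graph Theory library:
  finite, loop-free, with a symmetric arc relation. The vertices of a clustered graph with \<open>n\<close>
  clusters of \<open>m\<close> vertices are named by a labelling \<open>v\<close>: \<open>v i \<alpha>\<close> is the vertex number \<open>\<alpha>\<close>
  of the cluster number \<open>i\<close>. Both indices start at 0, as matrix indices do.
\<close>

definition clustered_graph ::
  "nat \<Rightarrow> nat \<Rightarrow> (nat \<Rightarrow> nat \<Rightarrow> 'a) \<Rightarrow> 'a pair_pre_digraph \<Rightarrow> bool" where
  "clustered_graph n m v G \<longleftrightarrow>
     pair_graph G \<and> bij_betw (\<lambda>(i, \<alpha>). v i \<alpha>) ({..<n} \<times> {..<m}) (pverts G)"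

definition cluster :: "nat \<Rightarrow> (nat \<Rightarrow> nat \<Rightarrow> 'a) \<Rightarrow> nat \<Rightarrow> 'a set" where
  "cluster m v i = v i ` {..<m}"

text \<open>Entries are complex so that the characteristic polynomial splits.\<close>

definition adj_block ::
  "nat \<Rightarrow> (nat \<Rightarrow> nat \<Rightarrow> 'a) \<Rightarrow> 'a pair_pre_digraph \<Rightarrow> nat \<Rightarrow> nat \<Rightarrow> complex mat" where
  "adj_block m v G i j = mat m m (\<lambda>(\<alpha>, \<beta>). if (v i \<alpha>, v j \<beta>) \<in> parcs G then 1 else 0)"

definition adj_matrix ::
  "nat \<Rightarrow> nat \<Rightarrow> (nat \<Rightarrow> nat \<Rightarrow> 'a) \<Rightarrow> 'a pair_pre_digraph \<Rightarrow> complex mat" where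
  "adj_matrix n m v G = mat (n * m) (n * m)
     (\<lambda>(r, s). adj_block m v G (r div m) (s div m) $$ (r mod m, s mod m))"

text \<open>Roots of the characteristic polynomial, counted with (algebraic) multiplicity.\<close>

definition adj_eigenvalues ::
  "nat \<Rightarrow> nat \<Rightarrow> (nat \<Rightarrow> nat \<Rightarrow> 'a) \<Rightarrow> 'a pair_pre_digraph \<Rightarrow> complex multiset" where
  "adj_eigenvalues n m v G = proots (char_poly (adj_matrix n m v G))"

definition cospectral ::
  "nat \<Rightarrow> nat \<Rightarrow> (nat \<Rightarrow> nat \<Rightarrow> 'a) \<Rightarrow> 'a pair_pre_digraph \<Rightarrow> 'a pair_pre_digraph \<Rightarrow> bool" where
  "cospectral n m v G G' \<longleftrightarrow> adj_eigenvalues n m v G = adj_eigenvalues n m v G'"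

definition nbd ::
  "nat \<Rightarrow> (nat \<Rightarrow> nat \<Rightarrow> 'a) \<Rightarrow> 'a pair_pre_digraph \<Rightarrow> nat \<Rightarrow> 'a \<Rightarrow> nat set" where
  "nbd m v G j x = {\<beta>. \<beta> < m \<and> (x, v j \<beta>) \<in> parcs G}"

definition commuting_condition ::
  "nat \<Rightarrow> nat \<Rightarrow> (nat \<Rightarrow> nat \<Rightarrow> 'a) \<Rightarrow> 'a pair_pre_digraph \<Rightarrow> bool" where
  "commuting_condition n m v G \<longleftrightarrow>
     (\<forall>i1<n. \<forall>j1<n. \<forall>i2<n. \<forall>j2<n. \<forall>\<alpha><m. \<forall>\<beta><m.
        card (nbd m v G j1 (v i1 \<alpha>) \<inter> nbd m v G i2 (v j2 \<beta>)) =
        card (nbd m v G i1 (v j1 \<beta>) \<inter> nbd m v G j2 (v i2 \<alpha>)))"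

definition common_neighbours ::
  "'a pair_pre_digraph \<Rightarrow> 'a set \<Rightarrow> 'a \<Rightarrow> 'a \<Rightarrow> 'a set" where
  "common_neighbours G C x y = {z \<in> C. (x, z) \<in> parcs G \<and> (y, z) \<in> parcs G}"

definition normality_condition ::
  "nat \<Rightarrow> nat \<Rightarrow> (nat \<Rightarrow> nat \<Rightarrow> 'a) \<Rightarrow> 'a pair_pre_digraph \<Rightarrow> bool" where
  "normality_condition n m v G \<longleftrightarrow>
     (\<forall>i<n. \<forall>j<n. i \<noteq> j \<longrightarrow> (\<forall>\<alpha><m. \<forall>\<beta><m.
        card (common_neighbours G (cluster m v j) (v i \<alpha>) (v i \<beta>)) =
        card (common_neighbours G (cluster m v i) (v j \<alpha>) (v j \<beta>))))"

definition partial_transpose ::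
  "nat \<Rightarrow> nat \<Rightarrow> (nat \<Rightarrow> nat \<Rightarrow> 'a) \<Rightarrow> 'a pair_pre_digraph \<Rightarrow> 'a pair_pre_digraph" where
  "partial_transpose n m v G =
     \<lparr> pverts = pverts G,
       parcs = {(v i \<alpha>, v j \<beta>) | i j \<alpha> \<beta>.
         i < n \<and> j < n \<and> \<alpha> < m \<and> \<beta> < m \<and> (v i \<beta>, v j \<alpha>) \<in> parcs G} \<rparr>"

lemma clustered_graph_label_eq_iff:
  assumes "clustered_graph n m v G" "i < n" "j < n" "\<alpha> < m" "\<beta> < m"
  shows "v i \<alpha> = v j \<beta> \<longleftrightarrow> i = j \<and> \<alpha> = \<beta>"
proof -
  have "inj_on (\<lambda>(i, \<alpha>). v i \<alpha>) ({..<n} \<times> {..<m})"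
    using assms(1) by (simp add: clustered_graph_def bij_betw_def)
  from inj_on_eq_iff[OF this, of "(i, \<alpha>)" "(j, \<beta>)"] show ?thesis
    using assms(2-) by simp
qed

lemma partial_transpose_arc_iff:
  assumes "clustered_graph n m v G" "i < n" "j < n" "\<alpha> < m" "\<beta> < m"
  shows "(v i \<alpha>, v j \<beta>) \<in> parcs (partial_transpose n m v G) \<longleftrightarrow> (v i \<beta>, v j \<alpha>) \<in> parcs G"
  using assms(2-) clustered_graph_label_eq_iff[OF assms(1)]
  by (fastforce simp: partial_transpose_def)

lemma adj_block_partial_transpose:
  assumes "clustered_graph n m v G" "i < n" "j < n"
  shows "adj_block m v (partial_transpose n m v G) i j = transpose_mat (adj_block m v G i j)"
  using assms by (intro eq_matI) (auto simp: adj_block_def partial_transpose_arc_iff)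

lemma clustered_graph_partial_transpose:
  assumes G: "clustered_graph n m v G"
  shows "clustered_graph n m v (partial_transpose n m v G)"
proof -
  interpret pair_graph G using G by (simp add: clustered_graph_def)
  have img: "(\<lambda>(i, \<alpha>). v i \<alpha>) ` ({..<n} \<times> {..<m}) = pverts G"
    using G by (simp add: clustered_graph_def bij_betw_def)
  have vin: "v i \<alpha> \<in> pverts G" if "i < n" "\<alpha> < m" for i \<alpha>
    using img that by force
  have sym: "(y, x) \<in> parcs G" if "(x, y) \<in> parcs G" for x y
    using that pair_sym_arcs by (simp add: symmetric_def sym_def)
  have irrefl: "(x, x) \<notin> parcs G" for x
    using pair_no_loops by force
  let ?T = "partial_transpose n m v G"
  have sub: "parcs ?T \<subseteq> pverts G \<times> pverts G"
    using vin by (auto simp: partial_transpose_def)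
  have "pair_graph ?T"
  proof
    fix e assume e: "e \<in> parcs ?T"
    then show "fst e \<in> pverts ?T" "snd e \<in> pverts ?T"
      using vin by (auto simp: partial_transpose_def)
    from e show "fst e \<noteq> snd e"
      using clustered_graph_label_eq_iff[OF G] irrefl by (auto simp: partial_transpose_def)
  next
    show "finite (pverts ?T)"
      using pair_finite_verts by (simp add: partial_transpose_def)
    show "finite (parcs ?T)"
      using sub pair_finite_verts by (meson finite_SigmaI finite_subset)
    show "symmetric ?T"
      using sym unfolding symmetric_def sym_def
      by (fastforce simp: partial_transpose_def)
  qed
  then show ?thesis
    using G by (simp add: clustered_graph_def partial_transpose_def)
qed

end

theory Submission
  imports Defs
begin

text \<open>
  Counting common neighbours, the commuting condition says that all blocks of \<open>G\<close> commute; as the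
  adjacency matrices are symmetric, partial transposition turns the block \<open>D\<^sub>p\<^sub>q\<close> of \<open>H\<close> into
  \<open>D\<^sub>q\<^sub>p\<close>. So the theorem follows from the fact that transposing a block matrix with commuting
  blocks blockwise, without transposing the blocks, preserves the characteristic polynomial. Over
  a commutative ring this is the invariance of the determinant under transposition. Here it is
  shown directly by block elimination: eliminating the first block column leaves the commuting
  blocks \<open>B\<^sub>0\<^sub>0 B\<^sub>p\<^sub>q - B\<^sub>p\<^sub>0 B\<^sub>0\<^sub>q\<close>, and this expression is compatible with swapping \<open>p\<close> and \<open>q\<close>.
\<close>

section \<open>Block matrices and their products\<close>

text \<open>Row and column counts of blocks are separate so that the first block row and first block
  column, cut off during elimination, are block matrices too. Only entries of \<open>B p q\<close>
  with both indices below \<open>m\<close> are read.\<close>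

definition block_mat :: "nat \<Rightarrow> nat \<Rightarrow> nat \<Rightarrow> (nat \<Rightarrow> nat \<Rightarrow> 'a mat) \<Rightarrow> 'a mat" where
  "block_mat a b m B = mat (a * m) (b * m) (\<lambda>(r, s). B (r div m) (s div m) $$ (r mod m, s mod m))"

lemma block_mat_carrier [simp]: "block_mat a b m B \<in> carrier_mat (a * m) (b * m)"
  by (simp add: block_mat_def)

lemma dim_block_mat [simp]: "dim_row (block_mat a b m B) = a * m" "dim_col (block_mat a b m B) = b * m"
  by (simp_all add: block_mat_def)

lemma index_block_mat:
  "r < a * m \<Longrightarrow> s < b * m \<Longrightarrow> block_mat a b m B $$ (r, s) = B (r div m) (s div m) $$ (r mod m, s mod m)"
  by (simp add: block_mat_def)

lemma block_index_bounds:
  fixes r a m :: nat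
  assumes "r < a * m"
  shows "r div m < a" "r mod m < m"
  using assms by (simp_all add: less_mult_imp_div_less) (cases m; simp)

lemma block_mat_eqI:
  assumes "\<And>p q \<alpha> \<beta>. p < a \<Longrightarrow> q < b \<Longrightarrow> \<alpha> < m \<Longrightarrow> \<beta> < m \<Longrightarrow> B p q $$ (\<alpha>, \<beta>) = C p q $$ (\<alpha>, \<beta>)"
  shows "block_mat a b m B = block_mat a b m C"
  by (rule eq_matI) (auto simp: index_block_mat block_index_bounds intro!: assms)

lemma block_mat_single:
  assumes "B 0 0 \<in> carrier_mat m m"
  shows "block_mat (Suc 0) (Suc 0) m B = B 0 0"
  using assms by (intro eq_matI) (auto simp: index_block_mat)

text \<open>The inner index runs over \<open>b * m\<close> values; cut into \<open>b\<close>
  intervals of length \<open>m\<close>, each interval contributes one entry of a product of two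
  blocks.\<close>

lemma index_mult_block_mat:
  fixes B C :: "nat \<Rightarrow> nat \<Rightarrow> 'a :: comm_ring_1 mat"
  assumes B: "\<And>p u. p < a \<Longrightarrow> u < b \<Longrightarrow> B p u \<in> carrier_mat m m"
    and C: "\<And>u q. u < b \<Longrightarrow> q < c \<Longrightarrow> C u q \<in> carrier_mat m m"
    and r: "r < a * m" and s: "s < c * m"
  shows "(block_mat a b m B * block_mat b c m C) $$ (r, s) =
    (\<Sum>u<b. (B (r div m) u * C u (s div m)) $$ (r mod m, s mod m))"
proof -
  note bd = block_index_bounds[OF r] block_index_bounds[OF s]
  define f where "f i = B (r div m) (i div m) $$ (r mod m, i mod m) *
    C (i div m) (s div m) $$ (i mod m, s mod m)" for i
  have "(block_mat a b m B * block_mat b c m C) $$ (r, s) = (\<Sum>i<b * m. f i)"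
    using r s by (simp add: scalar_prod_def index_block_mat f_def atLeast0LessThan)
  also have "\<dots> = (\<Sum>u<b. sum f {u * m..<u * m + m})"
    by (rule sum.nat_group[symmetric])
  also have "\<dots> = (\<Sum>u<b. (B (r div m) u * C u (s div m)) $$ (r mod m, s mod m))"
  proof (rule sum.cong[OF refl])
    fix u assume "u \<in> {..<b}"
    then have u: "u < b" by simp
    have "sum f {u * m..<u * m + m} = (\<Sum>\<tau>=0..<m. f (\<tau> + u * m))"
      using sum.shift_bounds_nat_ivl[of f 0 "u * m" m] by (simp add: add.commute)
    also have "\<dots> = (\<Sum>\<tau>=0..<m. B (r div m) u $$ (r mod m, \<tau>) * C u (s div m) $$ (\<tau>, s mod m))"
      by (rule sum.cong) (auto simp: f_def)
    also have "\<dots> = (B (r div m) u * C u (s div m)) $$ (r mod m, s mod m)"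
      using B[OF bd(1) u] C[OF u bd(3)] bd by (simp add: scalar_prod_def)
    finally show "sum f {u * m..<u * m + m} = \<dots>" .
  qed
  finally show ?thesis .
qed

lemma block_mat_Suc:
  assumes "B 0 0 \<in> carrier_mat m m"
  shows "block_mat (Suc k) (Suc k) m B = four_block_mat (B 0 0)
    (block_mat (Suc 0) k m (\<lambda>p q. B p (Suc q))) (block_mat k (Suc 0) m (\<lambda>p q. B (Suc p) q))
    (block_mat k k m (\<lambda>p q. B (Suc p) (Suc q)))"
proof (rule eq_matI, goal_cases)
  case (1 r s)
  have shift: "t div m = Suc ((t - m) div m)" "t mod m = (t - m) mod m" "t - m < k * m"
    if "\<not> t < m" "t < m + k * m" for t
    using that by (auto simp: le_div_geq le_mod_geq) (cases "m = 0"; simp add: le_div_geq)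
  from 1 assms show ?case
    by (cases "r < m"; cases "s < m") (auto simp: index_block_mat shift)
qed (use assms in auto)

section \<open>Commutation rules and elimination of the first block column\<close>

lemma minus_mult_commute:
  fixes X Y Z :: "'a :: comm_ring_1 mat"
  assumes "X \<in> carrier_mat m m" "Y \<in> carrier_mat m m" "Z \<in> carrier_mat m m"
    and "X * Y = Y * X" "X * Z = Z * X"
  shows "X * (Y - Z) = (Y - Z) * X"
  using assms by (simp add: mult_minus_distrib_mat[of _ m m _ m] minus_mult_distrib_mat[of _ m m _ _ m])

lemma mult_mult_commute:
  fixes X Y Z :: "'a :: comm_ring_1 mat"
  assumes "X \<in> carrier_mat m m" "Y \<in> carrier_mat m m" "Z \<in> carrier_mat m m"
    and "X * Y = Y * X" "X * Z = Z * X"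
  shows "X * (Y * Z) = (Y * Z) * X"
proof -
  have "X * (Y * Z) = Y * X * Z"
    using assms(4) by (simp add: assoc_mult_mat[OF assms(1,2,3), symmetric])
  also have "\<dots> = Y * (Z * X)"
    using assms(5) by (simp add: assoc_mult_mat[OF assms(2,1,3)])
  also have "\<dots> = Y * Z * X"
    by (simp add: assoc_mult_mat[OF assms(2,3,1)])
  finally show ?thesis .
qed

text \<open>Peeling off one diagonal block at a time contributes a factor \<open>det A\<close> each.
  This makes the extra factor produced by elimination cancellable.\<close>

lemma det_block_diag_neq_0:
  fixes A :: "'a :: idom mat"
  assumes A: "A \<in> carrier_mat m m" "det A \<noteq> 0"
  shows "det (block_mat k k m (\<lambda>p q. if p = q then A else 0\<^sub>m m m)) \<noteq> 0"
proof (induction k)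
  case 0
  have "block_mat 0 0 m (\<lambda>p q. if p = q then A else 0\<^sub>m m m) \<in> carrier_mat 0 0"
    by (rule carrier_matI) simp_all
  then show ?case by (simp add: det_dim_zero)
next
  case (Suc k)
  let ?D = "\<lambda>p q. if p = q then A else 0\<^sub>m m m"
  have z: "block_mat k (Suc 0) m (\<lambda>p q. ?D (Suc p) q) = 0\<^sub>m (k * m) m"
    by (rule eq_matI) (auto simp: index_block_mat)
  have "det (block_mat (Suc k) (Suc k) m ?D) = det A * det (block_mat k k m ?D)"
    using A(1) by (subst block_mat_Suc, simp, subst det_four_block_mat_lower_left_zero[OF _ _ z])
      (auto intro!: carrier_matI)
  with Suc A(2) show ?case by simp
qed

text \<open>Instead of dividing by the corner \<open>A\<close>, all lower block rows are scaled by
  it: left multiplication by the lower triangular matrix with rows \<open>(1, 0)\<close> and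
  \<open>(-V, P)\<close>, where \<open>V\<close> is the block column below \<open>A\<close> and
  \<open>P\<close> is the block diagonal matrix of copies of \<open>A\<close>. The product is block
  upper triangular, and the multiplier has determinant \<open>det P\<close>.\<close>

lemma det_block_mat_Suc:
  fixes B :: "nat \<Rightarrow> nat \<Rightarrow> 'a :: idom mat"
  assumes B: "\<And>p q. p \<le> k \<Longrightarrow> q \<le> k \<Longrightarrow> B p q \<in> carrier_mat m m"
    and comm: "\<And>p. p \<le> k \<Longrightarrow> B p 0 * B 0 0 = B 0 0 * B p 0"
  shows "det (block_mat k k m (\<lambda>p q. if p = q then B 0 0 else 0\<^sub>m m m)) * det (block_mat (Suc k) (Suc k) m B) =
    det (B 0 0) * det (block_mat k k m (\<lambda>p q. B 0 0 * B (Suc p) (Suc q) - B (Suc p) 0 * B 0 (Suc q)))"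
proof -
  let ?A = "B 0 0"
  let ?U = "block_mat (Suc 0) k m (\<lambda>p q. B p (Suc q))"
  let ?V = "block_mat k (Suc 0) m (\<lambda>p q. B (Suc p) q)"
  let ?D = "block_mat k k m (\<lambda>p q. B (Suc p) (Suc q))"
  let ?P = "block_mat k k m (\<lambda>p q. if p = q then ?A else 0\<^sub>m m m)"
  let ?S = "block_mat k k m (\<lambda>p q. ?A * B (Suc p) (Suc q) - B (Suc p) 0 * B 0 (Suc q))"
  let ?Z = "0\<^sub>m m (k * m) :: 'a mat"
  have A: "?A \<in> carrier_mat m m" by (simp add: B)
  \<comment> \<open>Viewing the corner as a block matrix with a single block lets the block product
    formula apply to \<open>?V * ?A\<close>.\<close>
  have A': "?A = block_mat (Suc 0) (Suc 0) m B" using A by (simp add: block_mat_single)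
  have U: "?U \<in> carrier_mat m (k * m)" by (rule carrier_matI) simp_all
  have V: "?V \<in> carrier_mat (k * m) m" by (rule carrier_matI) simp_all
  have diag: "(\<Sum>u<k. ((if p = u then ?A else 0\<^sub>m m m) * C u) $$ (x, y)) = (?A * C p) $$ (x, y)"
    if p: "p < k" and xy: "x < m" "y < m" and C: "\<And>u. u < k \<Longrightarrow> C u \<in> carrier_mat m m" for p x y C
  proof -
    have "(\<Sum>u<k. ((if p = u then ?A else 0\<^sub>m m m) * C u) $$ (x, y)) =
        (\<Sum>u<k. if p = u then (?A * C u) $$ (x, y) else 0)"
    proof (rule sum.cong[OF refl])
      fix u assume "u \<in> {..<k}"
      then have "0\<^sub>m m m * C u = 0\<^sub>m m m" using C by (simp add: left_mult_zero_mat)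
      then show "((if p = u then ?A else 0\<^sub>m m m) * C u) $$ (x, y) =
          (if p = u then (?A * C u) $$ (x, y) else 0)"
        using xy by (cases "p = u") (simp_all del: index_mult_mat)
    qed
    then show ?thesis using p by (simp del: index_mult_mat)
  qed
  have PD: "(?P * ?D) $$ (r, s) = (?A * B (Suc (r div m)) (Suc (s div m))) $$ (r mod m, s mod m)"
    if "r < k * m" "s < k * m" for r s
    by (rule trans[OF index_mult_block_mat diag])
      (use that in \<open>auto simp: block_index_bounds Suc_le_eq intro!: B\<close>)
  have PV: "(?P * ?V) $$ (r, s) = (?A * B (Suc (r div m)) (s div m)) $$ (r mod m, s mod m)"
    if "r < k * m" "s < m" for r s
    by (rule trans[OF index_mult_block_mat diag])
      (use that in \<open>auto simp: block_index_bounds Suc_le_eq intro!: B\<close>)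
  have single: "(\<Sum>u<Suc 0. (f u :: 'a mat) $$ x) = f 0 $$ x" for f x
    by simp
  have VA: "(?V * block_mat (Suc 0) (Suc 0) m B) $$ (r, s) = (B (Suc (r div m)) 0 * B 0 (s div m)) $$ (r mod m, s mod m)"
    if "r < k * m" "s < m" for r s
    by (rule trans[OF index_mult_block_mat single])
      (use that in \<open>auto simp: block_index_bounds Suc_le_eq intro!: B\<close>)
  have VU: "(?V * ?U) $$ (r, s) = (B (Suc (r div m)) 0 * B 0 (Suc (s div m))) $$ (r mod m, s mod m)"
    if "r < k * m" "s < k * m" for r s
    by (rule trans[OF index_mult_block_mat single])
      (use that in \<open>auto simp: block_index_bounds Suc_le_eq intro!: B\<close>)
  \<comment> \<open>The lower left block of the product vanishes because each block of
    \<open>?V\<close> commutes with \<open>?A\<close>.\<close>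
  have e1: "- ?V * ?A + ?P * ?V = 0\<^sub>m (k * m) m"
  proof (rule eq_matI, goal_cases)
    case (1 r s)
    then have rs: "r < k * m" "s < m" by auto
    have "Suc (r div m) \<le> k" using block_index_bounds[OF rs(1)] by simp
    with comm have c: "B (Suc (r div m)) 0 * ?A = ?A * B (Suc (r div m)) 0" by blast
    have "(- ?V * ?A + ?P * ?V) $$ (r, s) = - (?V * ?A) $$ (r, s) + (?P * ?V) $$ (r, s)"
      using A V rs by simp
    also have "\<dots> = 0"
      using VA[OF rs] PV[OF rs] rs by (simp only: A'[symmetric] c div_less mod_less left_minus)
    finally show ?case using rs by simp
  qed (use A V in auto)
  have e2: "- ?V * ?U + ?P * ?D = ?S"
  proof (rule eq_matI, goal_cases)
    case (1 r s)
    then have rs: "r < k * m" "s < k * m" by auto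
    note bd = block_index_bounds[OF rs(1)] block_index_bounds[OF rs(2)]
    have BU: "B 0 (Suc (s div m)) \<in> carrier_mat m m" and BV: "B (Suc (r div m)) 0 \<in> carrier_mat m m"
      using bd by (auto intro!: B)
    have "(- ?V * ?U + ?P * ?D) $$ (r, s) = - (?V * ?U) $$ (r, s) + (?P * ?D) $$ (r, s)"
      using U V rs by simp
    also have "\<dots> = (?A * B (Suc (r div m)) (Suc (s div m))) $$ (r mod m, s mod m) -
        (B (Suc (r div m)) 0 * B 0 (Suc (s div m))) $$ (r mod m, s mod m)"
      unfolding VU[OF rs] PD[OF rs] by (rule uminus_add_conv_diff)
    also have "\<dots> = ?S $$ (r, s)"
      unfolding index_block_mat[OF rs] using bd BU BV by (intro index_minus_mat(1)[symmetric]) simp_all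
    finally show ?case .
  qed (use U V in auto)
  let ?F = "four_block_mat (1\<^sub>m m) ?Z (- ?V) ?P"
  have F: "?F \<in> carrier_mat (Suc k * m) (Suc k * m)"
    by (rule carrier_matI) simp_all
  have top: "1\<^sub>m m * ?A + ?Z * ?V = ?A" "1\<^sub>m m * ?U + ?Z * ?D = ?U"
    using A U V left_mult_zero_mat[OF block_mat_carrier, of m k k m "\<lambda>p q. B (Suc p) (Suc q)"]
    by (simp_all add: left_mult_zero_mat[OF V])
  have "?F * block_mat (Suc k) (Suc k) m B = four_block_mat ?A ?U (0\<^sub>m (k * m) m) ?S"
    unfolding block_mat_Suc[of B m k, OF A]
      mult_four_block_mat[OF one_carrier_mat zero_carrier_mat uminus_carrier_mat[OF V] block_mat_carrier
        A U V block_mat_carrier] top e1 e2 ..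
  then have "det ?F * det (block_mat (Suc k) (Suc k) m B) = det (four_block_mat ?A ?U (0\<^sub>m (k * m) m) ?S)"
    using det_mult[OF F block_mat_carrier, of B] by simp
  also have "\<dots> = det ?A * det ?S"
    using A U by (intro det_four_block_mat_lower_left_zero[of _ m _ "k * m"]) auto
  also have "det ?F = det ?P"
    using V by (subst det_four_block_mat_upper_right_zero[of _ m _ "k * m"]) auto
  finally show ?thesis .
qed

section \<open>Determinants as polynomials in a shift\<close>

text \<open>The witness is the determinant of \<open>A + X E\<close> over the polynomial ring, since
  evaluation at \<open>t\<close> commutes with determinants.\<close>

lemma det_affine_is_poly:
  fixes A E :: "'a :: comm_ring_1 mat"
  assumes A: "A \<in> carrier_mat n n" and E: "E \<in> carrier_mat n n"
  obtains p where "\<And>t. poly p t = det (A + t \<cdot>\<^sub>m E)"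
proof
  fix t
  let ?P = "map_mat (\<lambda>a. [:a:]) A + [:0, 1:] \<cdot>\<^sub>m map_mat (\<lambda>a. [:a:]) E"
  show "poly (det ?P) t = det (A + t \<cdot>\<^sub>m E)"
    by (rule poly_det_cong[of _ n]) (use A E in auto)
qed

text \<open>As a function of \<open>t\<close>, this determinant is the characteristic polynomial of
  \<open>- A\<close>, which is monic and so has finitely many roots.\<close>

lemma finite_singular_shifts:
  fixes A :: "'a :: field mat"
  assumes A: "A \<in> carrier_mat n n"
  shows "finite {t. det (A + t \<cdot>\<^sub>m 1\<^sub>m n) = 0}"
proof -
  have mA: "- A \<in> carrier_mat n n" using A by simp
  have "char_poly (- A) \<noteq> 0"
    using degree_monic_char_poly[OF mA] by auto
  moreover have "- char_matrix (- A) t = A + t \<cdot>\<^sub>m 1\<^sub>m n" for t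
    using A by (intro eq_matI) (auto simp: char_matrix_def)
  then have "det (A + t \<cdot>\<^sub>m 1\<^sub>m n) = poly (char_poly (- A)) t" for t
    by (simp add: char_poly_matrix[OF mA])
  ultimately show ?thesis
    by (simp add: poly_roots_finite)
qed

section \<open>Families of pairwise commuting blocks\<close>

lemma mult_minus_mult_commute:
  fixes X :: "'a :: comm_ring_1 mat"
  assumes "X \<in> carrier_mat m m" "Y1 \<in> carrier_mat m m" "Z1 \<in> carrier_mat m m"
    "Y2 \<in> carrier_mat m m" "Z2 \<in> carrier_mat m m"
    and "X * Y1 = Y1 * X" "X * Z1 = Z1 * X" "X * Y2 = Y2 * X" "X * Z2 = Z2 * X"
  shows "X * (Y1 * Z1 - Y2 * Z2) = (Y1 * Z1 - Y2 * Z2) * X"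
  using assms by (intro minus_mult_commute[of _ m] mult_mult_commute[of _ m] mult_carrier_mat) auto

definition pairwise_commuting :: "nat \<Rightarrow> nat \<Rightarrow> (nat \<Rightarrow> nat \<Rightarrow> 'a :: comm_ring_1 mat) \<Rightarrow> bool" where
  "pairwise_commuting k m B \<longleftrightarrow> (\<forall>p<k. \<forall>q<k. B p q \<in> carrier_mat m m \<and>
     (\<forall>p'<k. \<forall>q'<k. B p q * B p' q' = B p' q' * B p q))"

lemma pairwise_commutingD:
  assumes "pairwise_commuting k m B" "p < k" "q < k"
  shows "B p q \<in> carrier_mat m m"
    and "p' < k \<Longrightarrow> q' < k \<Longrightarrow> B p q * B p' q' = B p' q' * B p q"
  using assms unfolding pairwise_commuting_def by blast+

lemma pairwise_commuting_swap:
  "pairwise_commuting k m B \<Longrightarrow> pairwise_commuting k m (\<lambda>p q. B q p)"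
  unfolding pairwise_commuting_def by blast

text \<open>The commutant of a matrix is closed under products and differences. Applied twice: a new
  block commutes with all old blocks, hence with every expression built from them, in particular
  with the other new blocks.\<close>

lemma pairwise_commuting_schur:
  assumes "pairwise_commuting (Suc k) m B"
  shows "pairwise_commuting k m (\<lambda>p q. B 0 0 * B (Suc p) (Suc q) - B (Suc p) 0 * B 0 (Suc q))"
  unfolding pairwise_commuting_def
proof (intro allI impI conjI)
  note B = pairwise_commutingD[OF assms]
  fix p q assume pq: "p < k" "q < k"
  then show car: "B 0 0 * B (Suc p) (Suc q) - B (Suc p) 0 * B 0 (Suc q) \<in> carrier_mat m m"
    by (intro minus_carrier_mat mult_carrier_mat[of _ m m] B) auto
  fix p' q' assume pq': "p' < k" "q' < k"
  have *: "B 0 0 * B (Suc p) (Suc q) - B (Suc p) 0 * B 0 (Suc q) \<in> carrier_mat m m \<and>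
    (B 0 0 * B (Suc p) (Suc q) - B (Suc p) 0 * B 0 (Suc q)) * B u w =
    B u w * (B 0 0 * B (Suc p) (Suc q) - B (Suc p) 0 * B 0 (Suc q))" if "u < Suc k" "w < Suc k" for u w
    using car by (intro conjI mult_minus_mult_commute[symmetric, of _ m] B) (use that pq in auto)
  show "(B 0 0 * B (Suc p) (Suc q) - B (Suc p) 0 * B 0 (Suc q)) *
      (B 0 0 * B (Suc p') (Suc q') - B (Suc p') 0 * B 0 (Suc q')) =
      (B 0 0 * B (Suc p') (Suc q') - B (Suc p') 0 * B 0 (Suc q')) *
      (B 0 0 * B (Suc p) (Suc q) - B (Suc p) 0 * B 0 (Suc q))"
    by (intro mult_minus_mult_commute[of _ m] car B(1) conjunct2[OF *]) (use pq' in auto)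
qed

text \<open>Scalar matrices are central. The scalar may vary with the block, which covers both a
  shift of the corner alone and a shift of all diagonal blocks.\<close>

lemma pairwise_commuting_shift:
  assumes B: "pairwise_commuting k m B"
  shows "pairwise_commuting k m (\<lambda>p q. B p q + (c p q) \<cdot>\<^sub>m 1\<^sub>m m)"
  unfolding pairwise_commuting_def
proof (intro allI impI conjI)
  fix p q assume "p < k" "q < k"
  then show car: "B p q + c p q \<cdot>\<^sub>m 1\<^sub>m m \<in> carrier_mat m m" by (auto intro: pairwise_commutingD[OF B])
  fix p' q' assume "p' < k" "q' < k"
  with \<open>p < k\<close> \<open>q < k\<close> have X: "B p q \<in> carrier_mat m m" and Y: "B p' q' \<in> carrier_mat m m"
    and c: "B p q * B p' q' = B p' q' * B p q" by (auto intro: pairwise_commutingD[OF B])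
  have expand: "(X + x \<cdot>\<^sub>m 1\<^sub>m m) * (Y + y \<cdot>\<^sub>m 1\<^sub>m m) = X * Y + x \<cdot>\<^sub>m Y + y \<cdot>\<^sub>m (X + x \<cdot>\<^sub>m 1\<^sub>m m)"
    if "X \<in> carrier_mat m m" "Y \<in> carrier_mat m m" for X Y :: "'a mat" and x y
    using that by (simp add: add_mult_distrib_mat[of _ m m _ _ m] mult_add_distrib_mat[of _ m m _ m]
        mult_smult_distrib[of _ m m _ m] mult_smult_assoc_mat[of _ m m _ m])
  show "(B p q + c p q \<cdot>\<^sub>m 1\<^sub>m m) * (B p' q' + c p' q' \<cdot>\<^sub>m 1\<^sub>m m) =
    (B p' q' + c p' q' \<cdot>\<^sub>m 1\<^sub>m m) * (B p q + c p q \<cdot>\<^sub>m 1\<^sub>m m)"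
    unfolding expand[OF X Y] expand[OF Y X] c
    using X Y by (intro eq_matI) (auto simp: algebra_simps)
qed

section \<open>Invariance under swapping the block indices\<close>

text \<open>Eliminating in \<open>B\<close> and in its swap involves the same corner and the same
  factor \<open>det ?P\<close>, which is nonzero and cancels. What remains are two smaller block
  matrices that are swaps of each other.\<close>

lemma det_block_mat_swap_step:
  fixes B :: "nat \<Rightarrow> nat \<Rightarrow> 'a :: idom mat"
  assumes IH: "\<And>C :: nat \<Rightarrow> nat \<Rightarrow> 'a mat. pairwise_commuting k m C \<Longrightarrow>
      det (block_mat k k m C) = det (block_mat k k m (\<lambda>p q. C q p))"
    and B: "pairwise_commuting (Suc k) m B" and nz: "det (B 0 0) \<noteq> 0"
  shows "det (block_mat (Suc k) (Suc k) m B) = det (block_mat (Suc k) (Suc k) m (\<lambda>p q. B q p))"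
proof -
  let ?P = "block_mat k k m (\<lambda>p q. if p = q then B 0 0 else 0\<^sub>m m m)"
  let ?C = "\<lambda>p q. B 0 0 * B (Suc p) (Suc q) - B (Suc p) 0 * B 0 (Suc q)"
  let ?C' = "\<lambda>p q. B 0 0 * B (Suc q) (Suc p) - B 0 (Suc p) * B (Suc q) 0"
  have swap: "block_mat k k m ?C' = block_mat k k m (\<lambda>p q. ?C q p)"
    \<comment> \<open>The two subtracted products have their factors in opposite order;
      commutativity of the blocks identifies them.\<close>
    by (rule block_mat_eqI) (metis B Suc_less_eq pairwise_commutingD(2) zero_less_Suc)
  have "det ?P * det (block_mat (Suc k) (Suc k) m B) = det (B 0 0) * det (block_mat k k m ?C)"
    by (rule det_block_mat_Suc) (auto intro: pairwise_commutingD[OF B])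
  also have "\<dots> = det (B 0 0) * det (block_mat k k m ?C')"
    unfolding swap IH[OF pairwise_commuting_schur[OF B]] ..
  also have "\<dots> = det ?P * det (block_mat (Suc k) (Suc k) m (\<lambda>p q. B q p))"
    by (rule det_block_mat_Suc[symmetric, of k "\<lambda>p q. B q p" m]) (auto intro: pairwise_commutingD[OF B])
  finally show ?thesis
    using det_block_diag_neq_0[OF _ nz] pairwise_commutingD(1)[OF B] by simp
qed

lemma det_block_mat_swap:
  fixes B :: "nat \<Rightarrow> nat \<Rightarrow> 'a :: field_char_0 mat"
  assumes "pairwise_commuting k m B"
  shows "det (block_mat k k m B) = det (block_mat k k m (\<lambda>p q. B q p))"
  using assms
proof (induction k arbitrary: B)
  case 0
  have "block_mat 0 0 m B = block_mat 0 0 m (\<lambda>p q. B q p)"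
    by (rule block_mat_eqI) simp
  then show ?case by simp
next
  case (Suc k)
  \<comment> \<open>The step needs an invertible corner. Both sides are polynomials in a shift \<open>t\<close> of the corner
    which agree for all but finitely many \<open>t\<close>, hence also for \<open>t = 0\<close>.\<close>
  let ?c = "\<lambda>t p q. if p = 0 \<and> q = (0::nat) then t else 0 :: 'a"
  let ?B = "\<lambda>t p q. B p q + ?c t p q \<cdot>\<^sub>m 1\<^sub>m m"
  let ?M = "block_mat (Suc k) (Suc k) m"
  \<comment> \<open>\<open>?E\<close> has the identity in the corner block and zeros elsewhere, so
    shifting the corner adds a multiple of \<open>?E\<close>.\<close>
  let ?E = "?M (\<lambda>p q. ?c 1 p q \<cdot>\<^sub>m 1\<^sub>m m)"
  have affine: "?M (\<lambda>p q. C p q + ?c t p q \<cdot>\<^sub>m 1\<^sub>m m) = ?M C + t \<cdot>\<^sub>m ?E"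
    if "pairwise_commuting (Suc k) m C" for C t
  proof (rule eq_matI, goal_cases)
    case (1 r s)
    then have rs: "r < Suc k * m" "s < Suc k * m" by auto
    note bd = block_index_bounds[OF rs(1)] block_index_bounds[OF rs(2)]
    with pairwise_commutingD(1)[OF that bd(1) bd(3)] rs show ?case
      by (auto simp: index_block_mat)
  qed auto
  obtain p1 where p1: "\<And>t. poly p1 t = det (?M B + t \<cdot>\<^sub>m ?E)"
    using det_affine_is_poly[OF block_mat_carrier block_mat_carrier] by blast
  obtain p2 where p2: "\<And>t. poly p2 t = det (?M (\<lambda>p q. B q p) + t \<cdot>\<^sub>m ?E)"
    using det_affine_is_poly[OF block_mat_carrier block_mat_carrier] by blast
  have agree: "poly p1 t = poly p2 t" if "det (B 0 0 + t \<cdot>\<^sub>m 1\<^sub>m m) \<noteq> 0" for t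
  proof -
    have "det (?M (?B t)) = det (?M (\<lambda>p q. ?B t q p))"
      by (rule det_block_mat_swap_step[OF Suc.IH pairwise_commuting_shift[OF Suc.prems]])
        (use that in auto)
    \<comment> \<open>The corner lies on the block diagonal, so the swap leaves the shift in
      place.\<close>
    also have "?M (\<lambda>p q. ?B t q p) = ?M (\<lambda>p q. B q p + ?c t p q \<cdot>\<^sub>m 1\<^sub>m m)"
      by (rule block_mat_eqI) (simp add: conj_commute)
    finally show ?thesis
      unfolding p1 p2 affine[OF Suc.prems] affine[OF pairwise_commuting_swap[OF Suc.prems]] .
  qed
  have "finite {t. det (B 0 0 + t \<cdot>\<^sub>m 1\<^sub>m m) = 0}"
    using pairwise_commutingD(1)[OF Suc.prems] by (intro finite_singular_shifts) simp
  \<comment> \<open>Characteristic 0 makes the field infinite, so removing finitely many singular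
    shifts still leaves infinitely many roots of \<open>p1 - p2\<close>.\<close>
  then have "infinite (- {t. det (B 0 0 + t \<cdot>\<^sub>m 1\<^sub>m m) = 0})"
    using infinite_UNIV_char_0[where 'a = 'a] by (simp add: finite_compl)
  moreover have "- {t. det (B 0 0 + t \<cdot>\<^sub>m 1\<^sub>m m) = 0} \<subseteq> {t. poly (p1 - p2) t = 0}"
    using agree by auto
  ultimately have "infinite {t. poly (p1 - p2) t = 0}"
    using finite_subset by blast
  then have "p1 - p2 = 0"
    using poly_roots_finite by blast
  then have "poly p1 0 = poly p2 0" by simp
  moreover have "X + 0 \<cdot>\<^sub>m ?E = X" if "X \<in> carrier_mat (Suc k * m) (Suc k * m)" for X
    using that by (intro eq_matI) auto
  ultimately show ?case by (simp only: p1 p2 block_mat_carrier)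
qed

text \<open>Subtracting \<open>t\<close> times the identity only shifts the diagonal blocks: the
  blocks still commute and the swap fixes the shift. The determinant result thus applies at each
  \<open>t\<close>, and equality of all values gives equality of the polynomials.\<close>

lemma char_poly_block_mat_swap:
  fixes B :: "nat \<Rightarrow> nat \<Rightarrow> 'a :: field_char_0 mat"
  assumes B: "pairwise_commuting k m B"
  shows "char_poly (block_mat k k m B) = char_poly (block_mat k k m (\<lambda>p q. B q p))"
proof -
  let ?c = "\<lambda>t p q. if p = q then - t else 0 :: 'a"
  have char: "char_matrix (block_mat k k m C) t = block_mat k k m (\<lambda>p q. C p q + ?c t p q \<cdot>\<^sub>m 1\<^sub>m m)"
    if "pairwise_commuting k m C" for C t
  proof (rule eq_matI, goal_cases)
    case (1 r s)
    then have rs: "r < k * m" "s < k * m" by auto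
    note bd = block_index_bounds[OF rs(1)] block_index_bounds[OF rs(2)]
    have "r = s \<longleftrightarrow> r div m = s div m \<and> r mod m = s mod m"
      by (metis div_mult_mod_eq)
    with pairwise_commutingD(1)[OF that bd(1) bd(3)] rs bd show ?case
      by (auto simp: index_block_mat char_matrix_def)
  qed (auto simp: char_matrix_def)
  have "poly (char_poly (block_mat k k m B)) t = poly (char_poly (block_mat k k m (\<lambda>p q. B q p))) t" for t
  proof -
    have "det (char_matrix (block_mat k k m B) t) =
        det (block_mat k k m (\<lambda>p q. B q p + ?c t q p \<cdot>\<^sub>m 1\<^sub>m m))"
      unfolding char[OF B] by (rule det_block_mat_swap[OF pairwise_commuting_shift[OF B]])
    also have "(\<lambda>p q. B q p + ?c t q p \<cdot>\<^sub>m 1\<^sub>m m) = (\<lambda>p q. B q p + ?c t p q \<cdot>\<^sub>m 1\<^sub>m m)"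
      by (intro ext) auto
    also have "det (block_mat k k m \<dots>) = det (char_matrix (block_mat k k m (\<lambda>p q. B q p)) t)"
      unfolding char[OF pairwise_commuting_swap[OF B]] ..
    finally have eq: "det (char_matrix (block_mat k k m B) t) = \<dots>" .
    \<comment> \<open>The characteristic polynomial is evaluated through the negated
      \<open>char_matrix\<close>; the resulting sign is the same on both sides.\<close>
    have "det (- X) = (- 1) ^ (k * m) * det X" if "X \<in> carrier_mat (k * m) (k * m)" for X :: "'a mat"
    proof -
      have "- X = (- 1) \<cdot>\<^sub>m X" by (intro eq_matI) auto
      then show ?thesis using that by (simp add: det_smult)
    qed
    with eq show ?thesis
      by (simp add: char_poly_matrix[OF block_mat_carrier])
  qed
  then show ?thesis by (simp add: poly_eq_poly_eq_iff[symmetric] fun_eq_iff)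
qed

section \<open>Adjacency blocks of clustered graphs\<close>

lemma adj_matrix_eq_block_mat: "adj_matrix n m v G = block_mat n n m (adj_block m v G)"
  by (simp add: adj_matrix_def block_mat_def)

lemma adj_block_carrier [simp]: "adj_block m v G i j \<in> carrier_mat m m"
  by (simp add: adj_block_def)

lemma clustered_graph_arc_sym:
  assumes "clustered_graph n m v G"
  shows "(x, y) \<in> parcs G \<longleftrightarrow> (y, x) \<in> parcs G"
proof -
  interpret pair_graph G using assms by (simp add: clustered_graph_def)
  show ?thesis using pair_sym_arcs by (auto simp: symmetric_def sym_def)
qed

lemma transpose_adj_block:
  "clustered_graph n m v G \<Longrightarrow> transpose_mat (adj_block m v G i j) = adj_block m v G j i"
  by (rule eq_matI) (auto simp: adj_block_def clustered_graph_arc_sym)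

text \<open>By symmetry of the arcs, column \<open>\<beta>\<close> of the second factor is the
  indicator of the neighbours of \<open>v j' \<beta>\<close> in cluster \<open>i'\<close>, so the
  scalar product counts shared index labels.\<close>

lemma index_mult_adj_block:
  assumes G: "clustered_graph n m v G" and "\<alpha> < m" "\<beta> < m"
  shows "(adj_block m v G i j * adj_block m v G i' j') $$ (\<alpha>, \<beta>) =
    of_nat (card (nbd m v G j (v i \<alpha>) \<inter> nbd m v G i' (v j' \<beta>)))"
proof -
  let ?N = "nbd m v G j (v i \<alpha>) \<inter> nbd m v G i' (v j' \<beta>)"
  have "(adj_block m v G i j * adj_block m v G i' j') $$ (\<alpha>, \<beta>) = (\<Sum>\<gamma>=0..<m. if \<gamma> \<in> ?N then 1 else 0)"
    using assms(2,3) by (auto simp: adj_block_def scalar_prod_def nbd_def clustered_graph_arc_sym[OF G, of _ "v j' \<beta>"]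
        intro!: sum.cong)
  also have "\<dots> = of_nat (card ({0..<m} \<inter> ?N))"
    by (simp add: sum.If_cases del: Int_iff)
  also have "{0..<m} \<inter> ?N = ?N" by (auto simp: nbd_def)
  finally show ?thesis .
qed

text \<open>The two sides of the commuting condition are the entries at
  \<open>(\<alpha>, \<beta>)\<close> of the two products, up to the order of the intersection on the
  right.\<close>

lemma adj_block_commute:
  assumes G: "clustered_graph n m v G" and cc: "commuting_condition n m v G"
    and ij: "i < n" "j < n" "i' < n" "j' < n"
  shows "adj_block m v G i j * adj_block m v G i' j' = adj_block m v G i' j' * adj_block m v G i j"
proof (rule eq_matI)
  fix \<alpha> \<beta>
  assume "\<alpha> < dim_row (adj_block m v G i' j' * adj_block m v G i j)"
    "\<beta> < dim_col (adj_block m v G i' j' * adj_block m v G i j)"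
  then have ab: "\<alpha> < m" "\<beta> < m" by (simp_all add: adj_block_def)
  have "card (nbd m v G j (v i \<alpha>) \<inter> nbd m v G i' (v j' \<beta>)) =
      card (nbd m v G j' (v i' \<alpha>) \<inter> nbd m v G i (v j \<beta>))"
    using cc[unfolded commuting_condition_def, rule_format, OF ij ab]
    by (simp only: Int_commute[of "nbd m v G i (v j \<beta>)"])
  then show "(adj_block m v G i j * adj_block m v G i' j') $$ (\<alpha>, \<beta>) =
      (adj_block m v G i' j' * adj_block m v G i j) $$ (\<alpha>, \<beta>)"
    by (simp only: index_mult_adj_block[OF G ab])
qed (simp_all add: adj_block_def)

theorem theorem8:
  fixes n m k :: nat
    and v :: "nat \<Rightarrow> nat \<Rightarrow> 'a" and G :: "'a pair_pre_digraph"
    and w :: "nat \<Rightarrow> nat \<Rightarrow> 'b" and H :: "'b pair_pre_digraph"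
  assumes "clustered_graph n m v G"
    and "commuting_condition n m v G"
    and "normality_condition n m v G"
    and "k \<ge> 2"
    and "clustered_graph k m w H"
    and "\<forall>p<k. \<exists>i<n. adj_block m w H p p = adj_block m v G i i"
    and "\<forall>p<k. \<forall>q<k. p \<noteq> q \<longrightarrow>
           adj_block m w H p q \<in>
             {1\<^sub>m m, 0\<^sub>m m m} \<union> {adj_block m v G i j | i j. i < n \<and> j < n \<and> i \<noteq> j}"
  shows "cospectral k m w H (partial_transpose k m w H)"
proof -
  \<comment> \<open>A single commuting pool for all blocks of \<open>H\<close>. It admits
    \<open>i = j\<close>, because the diagonal blocks of \<open>H\<close> are diagonal blocks of
    \<open>G\<close>.\<close>
  define S where "S = {1\<^sub>m m, 0\<^sub>m m m} \<union> {adj_block m v G i j | i j. i < n \<and> j < n}"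
  have S_comm: "X * Y = Y * X" if "X \<in> S" "Y \<in> S" for X Y
    using that
    by (auto simp: S_def left_mult_one_mat[OF adj_block_carrier] right_mult_one_mat[OF adj_block_carrier]
        left_mult_zero_mat[OF adj_block_carrier] right_mult_zero_mat[OF adj_block_carrier]
        intro: adj_block_commute[OF assms(1,2)])
  have HS: "adj_block m w H p q \<in> S" if "p < k" "q < k" for p q
  proof (cases "p = q")
    case True
    then obtain i where "i < n" "adj_block m w H p q = adj_block m v G i i"
      using assms(6) \<open>p < k\<close> by blast
    then show ?thesis unfolding S_def by blast
  next
    case False
    with assms(7) that have "adj_block m w H p q \<in>
      {1\<^sub>m m, 0\<^sub>m m m} \<union> {adj_block m v G i j | i j. i < n \<and> j < n \<and> i \<noteq> j}"
      by blast
    then show ?thesis unfolding S_def by blast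
  qed
  have "pairwise_commuting k m (adj_block m w H)"
    unfolding pairwise_commuting_def by (intro allI impI conjI S_comm HS adj_block_carrier)
  from char_poly_block_mat_swap[OF this]
  have "char_poly (block_mat k k m (adj_block m w H)) = char_poly (block_mat k k m (\<lambda>p q. adj_block m w H q p))" .
  \<comment> \<open>Symmetry of \<open>H\<close> makes the transpose of block \<open>(p, q)\<close>
    equal to block \<open>(q, p)\<close>, so partial transposition is exactly the swap.\<close>
  also have "block_mat k k m (\<lambda>p q. adj_block m w H q p) =
      block_mat k k m (adj_block m w (partial_transpose k m w H))"
    by (rule block_mat_eqI)
      (simp add: adj_block_partial_transpose[OF assms(5)] transpose_adj_block[OF assms(5)])
  finally show ?thesis
    by (simp add: cospectral_def adj_eigenvalues_def adj_matrix_eq_block_mat)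
qed

end
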